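(* Let $\Gamma$ be a signed graph containing a special path $Pv_1v_2v_3$, where $\sigma(v_1v_2)=-1$ and $\sigma(v_2v_3)=1$. Let $\Gamma'$ be the signed graph obtained from $\Gamma$ by contracting the path $Pv_1v_2v_3$ into a single vertex. Then $\eta(\Gamma')=\eta(\Gamma)$.
   Context: A signed graph $\Gamma=(G,\sigma)$ consists of a finite simple graph $G=(V,E)$ and a map $\sigma:E\to\{+,-\}$ (identified with $\{+1,-1\}$). Its adjacency matrix is the symmetric matrix $A(\Gamma)$ whose $(i,j)$ entry is $\sigma(v_iv_j)$ if $v_iv_j\in E$ and $0$ otherwise. The nullity $\eta(\Gamma)$ is the multiplicity of $0$ as an eigenvalue of $A(\Gamma)$. $N(v)$ denotes the set of neighbors of the vertex $v$ in $\Gamma$ and $d(v)=|N(v)|$. $Pv_1v_2v_3$ denotes a path on distinct vertices $v_1,v_2,v_3$ with edges $v_1v_2,v_2v_3$. Such a path contained in $\Gamma$ is called a special path of $\Gamma$ if $d(v_2)=2$, $v_1v_3\notin E(\Gamma)$, and $(N(v_1)\cap N(v_3))\setminus\{v_2\}=\emptyset$. Contracting the special path into a single vertex means: delete $v_1,v_2,v_3$, add one new vertex $u$, and join $u$ to each vertex $w\in (N(v_1)\cup N(v_3))\setminus\{v_2\}$ by an edge having the sign of the (unique) edge $wv_1$ or $wv_3$ of $\Gamma$; all other edges and signs are unchanged. *)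

theory Defs
  imports "Jordan_Normal_Form.Char_Poly" "HOL-Combinatorics.List_Permutation"
begin

(* Edges are two-element sets of vertices; the values of esign outside the edge set are irrelevant. *)
record 'a sgraph =
  verts :: "'a set"
  edges :: "'a set set"
  esign :: "'a set \<Rightarrow> int"

definition signed_graph :: "'a sgraph \<Rightarrow> bool" where
  "signed_graph \<Gamma> \<longleftrightarrow>
     finite (verts \<Gamma>) \<and>
     edges \<Gamma> \<subseteq> {{x, y} | x y. x \<in> verts \<Gamma> \<and> y \<in> verts \<Gamma> \<and> x \<noteq> y} \<and>
     (\<forall>e \<in> edges \<Gamma>. esign \<Gamma> e \<in> {1, -1})"

definition nbrs :: "'a sgraph \<Rightarrow> 'a \<Rightarrow> 'a set" where
  "nbrs \<Gamma> v = {w \<in> verts \<Gamma>. {v, w} \<in> edges \<Gamma>}"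

definition vdeg :: "'a sgraph \<Rightarrow> 'a \<Rightarrow> nat" where
  "vdeg \<Gamma> v = card (nbrs \<Gamma> v)"

definition adj_matrix :: "'a sgraph \<Rightarrow> 'a list \<Rightarrow> real mat" where
  "adj_matrix \<Gamma> vs = mat (length vs) (length vs)
     (\<lambda>(i, j). if {vs ! i, vs ! j} \<in> edges \<Gamma> then of_int (esign \<Gamma> {vs ! i, vs ! j}) else 0)"

(* The enumeration of the vertices is an arbitrary choice; nullity_enum below shows that the
   result does not depend on it. *)
definition nullity :: "'a sgraph \<Rightarrow> nat" where
  "nullity \<Gamma> =
     order 0 (char_poly (adj_matrix \<Gamma> (SOME vs. distinct vs \<and> set vs = verts \<Gamma>)))"

definition special_path :: "'a sgraph \<Rightarrow> 'a \<Rightarrow> 'a \<Rightarrow> 'a \<Rightarrow> bool" where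
  "special_path \<Gamma> v1 v2 v3 \<longleftrightarrow>
     v1 \<in> verts \<Gamma> \<and> v2 \<in> verts \<Gamma> \<and> v3 \<in> verts \<Gamma> \<and> distinct [v1, v2, v3] \<and>
     {v1, v2} \<in> edges \<Gamma> \<and> {v2, v3} \<in> edges \<Gamma> \<and>
     vdeg \<Gamma> v2 = 2 \<and> {v1, v3} \<notin> edges \<Gamma> \<and> (nbrs \<Gamma> v1 \<inter> nbrs \<Gamma> v3) - {v2} = {}"

(* u is the new vertex; it is meant to satisfy "u \<notin> verts \<Gamma> - {v1, v2, v3}", so the name of a
   deleted vertex may be reused. For an edge e = {u, w} the set insert v1 (e - {u}) is {v1, w}. *)
definition contract_path :: "'a sgraph \<Rightarrow> 'a \<Rightarrow> 'a \<Rightarrow> 'a \<Rightarrow> 'a \<Rightarrow> 'a sgraph" where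
  "contract_path \<Gamma> v1 v2 v3 u =
     \<lparr> verts = insert u (verts \<Gamma> - {v1, v2, v3}),
       edges = {e \<in> edges \<Gamma>. e \<inter> {v1, v2, v3} = {}} \<union>
               {{u, w} | w. w \<in> (nbrs \<Gamma> v1 \<union> nbrs \<Gamma> v3) - {v2}},
       esign = (\<lambda>e. if u \<in> e
                    then (if insert v1 (e - {u}) \<in> edges \<Gamma> then esign \<Gamma> (insert v1 (e - {u}))
                          else esign \<Gamma> (insert v3 (e - {u})))
                    else esign \<Gamma> e) \<rparr>"

lemma char_poly_adj_matrix_enum:
  assumes "distinct vs" "distinct ws" "set vs = set ws"
  shows "char_poly (adj_matrix \<Gamma> vs) = char_poly (adj_matrix \<Gamma> ws)"
proof -
  define n where "n = length ws"
  have "mset vs = mset ws"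
    using assms by (simp add: set_eq_iff_mset_eq_distinct)
  then obtain p where p: "p permutes {..<n}" "permute_list p ws = vs"
    using mset_eq_permutation n_def by metis
  have len: "length vs = n"
    using p(2) n_def by auto
  have vs: "vs ! i = ws ! p i" if "i < n" for i
    using p that permute_list_nth[of p ws i] by (simp add: n_def)
  have p0: "p permutes {0..<n}"
    using p(1) by (simp add: atLeast0LessThan)
  have pn: "p i < n" if "i < n" for i
    using permutes_in_image[OF p(1), of i] that by simp
  have pinj: "p i = p j \<longleftrightarrow> i = j" for i j
    using permutes_inj[OF p(1)] by (auto dest: injD)
  define M where "M = char_poly_matrix (adj_matrix \<Gamma> ws)"
  have M: "M \<in> carrier_mat n n"
    by (simp add: M_def char_poly_matrix_def adj_matrix_def n_def)
  define R where "R = mat n n (\<lambda>(i, j). M $$ (p i, j))"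
  have R: "R \<in> carrier_mat n n"
    by (simp add: R_def)
  define S where "S = mat n n (\<lambda>(i, j). transpose_mat R $$ (p i, j))"
  have S: "S \<in> carrier_mat n n"
    by (simp add: S_def)
  have "char_poly_matrix (adj_matrix \<Gamma> vs) = transpose_mat S"
    by (rule eq_matI)
       (auto simp: S_def R_def M_def char_poly_matrix_def adj_matrix_def len n_def[symmetric]
          vs pn pinj)
  then have "char_poly (adj_matrix \<Gamma> vs) = det S"
    using det_transpose[OF S] by (simp add: char_poly_def)
  also have "\<dots> = signof p * det (transpose_mat R)"
    unfolding S_def by (rule det_permute_rows[OF _ p0]) (use R in simp)
  also have "\<dots> = signof p * (signof p * det M)"
    using det_permute_rows[OF M p0] det_transpose[OF R] by (simp add: R_def)
  also have "\<dots> = det M"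
    by (cases "sign p = 1") (auto simp: sign_def)
  finally show ?thesis
    by (simp add: M_def char_poly_def)
qed

lemma nullity_enum:
  assumes "distinct vs" "set vs = verts \<Gamma>"
  shows "nullity \<Gamma> = order 0 (char_poly (adj_matrix \<Gamma> vs))"
proof -
  have "distinct (SOME vs. distinct vs \<and> set vs = verts \<Gamma>) \<and>
        set (SOME vs. distinct vs \<and> set vs = verts \<Gamma>) = verts \<Gamma>"
    using assms by (intro someI[of "\<lambda>vs. distinct vs \<and> set vs = verts \<Gamma>"]) simp
  then show ?thesis
    unfolding nullity_def using assms by (metis char_poly_adj_matrix_enum)
qed

lemma nbrs_not_path:
  assumes "signed_graph \<Gamma>" "special_path \<Gamma> v1 v2 v3" "w \<in> (nbrs \<Gamma> v1 \<union> nbrs \<Gamma> v3) - {v2}"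
  shows "w \<in> verts \<Gamma> - {v1, v2, v3}"
proof -
  have "{x} \<notin> edges \<Gamma>" for x
    using assms(1) by (fastforce simp: signed_graph_def)
  then show ?thesis
    using assms(2,3) by (auto simp: nbrs_def special_path_def insert_commute)
qed

lemma esign_contract_path:
  assumes "signed_graph \<Gamma>" "special_path \<Gamma> v1 v2 v3" "u \<notin> verts \<Gamma> - {v1, v2, v3}"
  shows "w \<in> nbrs \<Gamma> v1 - {v2} \<Longrightarrow> esign (contract_path \<Gamma> v1 v2 v3 u) {u, w} = esign \<Gamma> {w, v1}"
    and "w \<in> nbrs \<Gamma> v3 - {v2} \<Longrightarrow> esign (contract_path \<Gamma> v1 v2 v3 u) {u, w} = esign \<Gamma> {w, v3}"
    and "e \<in> edges \<Gamma> \<Longrightarrow> e \<inter> {v1, v2, v3} = {} \<Longrightarrow>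
           esign (contract_path \<Gamma> v1 v2 v3 u) e = esign \<Gamma> e"
proof -
  have *: "{u, w} - {u} = {w}" if "w \<in> (nbrs \<Gamma> v1 \<union> nbrs \<Gamma> v3) - {v2}" for w
    using nbrs_not_path[OF assms(1,2) that] assms(3) by auto
  show "esign (contract_path \<Gamma> v1 v2 v3 u) {u, w} = esign \<Gamma> {w, v1}" if "w \<in> nbrs \<Gamma> v1 - {v2}"
    using *[of w] that by (auto simp: contract_path_def nbrs_def insert_commute)
  show "esign (contract_path \<Gamma> v1 v2 v3 u) {u, w} = esign \<Gamma> {w, v3}" if "w \<in> nbrs \<Gamma> v3 - {v2}"
    using *[of w] that assms(2)
    by (auto simp: contract_path_def nbrs_def special_path_def insert_commute)
  show "esign (contract_path \<Gamma> v1 v2 v3 u) e = esign \<Gamma> e"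
    if "e \<in> edges \<Gamma>" "e \<inter> {v1, v2, v3} = {}"
    using that assms(1,3) by (auto simp: contract_path_def signed_graph_def)
qed

lemma signed_graph_contract_path:
  assumes "signed_graph \<Gamma>" "special_path \<Gamma> v1 v2 v3" "u \<notin> verts \<Gamma> - {v1, v2, v3}"
  shows "signed_graph (contract_path \<Gamma> v1 v2 v3 u)"
proof -
  let ?C = "contract_path \<Gamma> v1 v2 v3 u" and ?N = "(nbrs \<Gamma> v1 \<union> nbrs \<Gamma> v3) - {v2}"
  have N: "w \<in> verts \<Gamma> - {v1, v2, v3}" if "w \<in> ?N" for w
    using nbrs_not_path[OF assms(1,2) that] .
  have E: "edges ?C = {e \<in> edges \<Gamma>. e \<inter> {v1, v2, v3} = {}} \<union> {{u, w} | w. w \<in> ?N}"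
    by (simp add: contract_path_def)
  have V: "verts ?C = insert u (verts \<Gamma> - {v1, v2, v3})"
    by (simp add: contract_path_def)
  have "\<exists>x y. e = {x, y} \<and> x \<in> verts ?C \<and> y \<in> verts ?C \<and> x \<noteq> y \<and> esign ?C e \<in> {1, -1}"
    if "e \<in> edges ?C" for e
  proof -
    consider (old) "e \<in> edges \<Gamma>" "e \<inter> {v1, v2, v3} = {}" | (new) w where "e = {u, w}" "w \<in> ?N"
      using \<open>e \<in> edges ?C\<close> unfolding E by blast
    then show ?thesis
    proof cases
      case old
      obtain x y where "e = {x, y}" "x \<in> verts \<Gamma>" "y \<in> verts \<Gamma>" "x \<noteq> y"
        using assms(1) old(1) unfolding signed_graph_def by blast
      moreover have "esign \<Gamma> e \<in> {1, -1}"
        using assms(1) old(1) unfolding signed_graph_def by blast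
      ultimately show ?thesis
        using old esign_contract_path(3)[OF assms old] unfolding V by auto
    next
      case new
      have "u \<noteq> w" "w \<in> verts ?C" "u \<in> verts ?C"
        using N[OF new(2)] assms(3) unfolding V by auto
      moreover have "esign ?C e \<in> {1, -1}"
      proof (cases "w \<in> nbrs \<Gamma> v1")
        case True
        then have "esign ?C e = esign \<Gamma> {w, v1}" "{w, v1} \<in> edges \<Gamma>"
          using esign_contract_path(1)[OF assms, of w] True new
          by (simp_all add: nbrs_def insert_commute)
        then show ?thesis using assms(1) unfolding signed_graph_def by metis
      next
        case False
        then have "esign ?C e = esign \<Gamma> {w, v3}" "{w, v3} \<in> edges \<Gamma>"
          using esign_contract_path(2)[OF assms, of w] False new
          by (auto simp: nbrs_def insert_commute)
        then show ?thesis using assms(1) unfolding signed_graph_def by metis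
      qed
      ultimately show ?thesis using new(1) by blast
    qed
  qed
  then show ?thesis
    using assms(1) unfolding signed_graph_def V by blast
qed

end

(* Order the vertices as v2, v3, v1, followed by the rest. The leading 2x2 block of A(Gamma), for
   v2 and v3, is [[0, 1], [1, 0]], hence invertible, and its Schur complement in A(Gamma) is exactly
   the adjacency matrix of the contracted graph, with u in the position of v1. Block elimination
   preserves the kernel dimension, and for a real symmetric matrix this dimension equals the
   algebraic multiplicity of the eigenvalue 0. *)
theory Submission
  imports Defs
    "Jordan_Normal_Form.Jordan_Normal_Form_Uniqueness"
    "Jordan_Normal_Form.Jordan_Normal_Form_Existence"
begin

section \<open>Multiplicity of the root 0 and kernel dimension for real symmetric matrices\<close>

text \<open>Termwise \<open>min 1 n\<close> \<le> \<open>min 2 n\<close>, so equal sums force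
  equality in every term, and then each \<open>n\<close> is at most 1. It is applied to the sizes of
  the Jordan blocks for the eigenvalue 0.\<close>

lemma sum_list_min_1_eq_min_2:
  fixes ns :: "nat list"
  assumes "(\<Sum>n\<leftarrow>ns. min 1 n) = (\<Sum>n\<leftarrow>ns. min 2 n)"
  shows "sum_list ns = (\<Sum>n\<leftarrow>ns. min 1 n)"
  using assms
proof (induction ns)
  case (Cons n ns)
  have "(\<Sum>n\<leftarrow>ns. min 1 n) \<le> (\<Sum>n\<leftarrow>ns. min 2 n)"
    by (rule sum_list_mono) simp
  moreover have "min 1 n + (\<Sum>n\<leftarrow>ns. min 1 n) = min 2 n + (\<Sum>n\<leftarrow>ns. min 2 n)"
    using Cons.prems by simp
  ultimately have "min 1 n = min 2 n" "(\<Sum>n\<leftarrow>ns. min 1 n) = (\<Sum>n\<leftarrow>ns. min 2 n)"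
    by linarith+
  then show ?case
    using Cons.IH by (simp add: min_def split: if_splits)
qed simp

text \<open>
  If a matrix and its square have the same kernel, then all Jordan blocks for the eigenvalue 0
  have size 1: with block sizes \<open>ns\<close>, the kernel of the \<open>k\<close>-th power has dimension
  \<open>\<Sum>n\<leftarrow>ns. min k n\<close>.
\<close>

lemma order_char_poly_eq_kernel_dim:
  fixes A :: "complex mat"
  assumes A: "A \<in> carrier_mat n n" and ker: "mat_kernel (A * A) = mat_kernel A"
  shows "Polynomial.order 0 (char_poly A) = kernel_dim A"
proof -
  \<comment> \<open>Over the complex numbers the characteristic polynomial splits, which yields a
    Jordan normal form.\<close>
  obtain as where "char_poly A = (\<Prod>a\<leftarrow>as. [:- a, 1:])"
    using char_poly_factorized[OF A] by blast
  then obtain n_as where jnf: "jordan_nf A n_as"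
    using jordan_nf_exists[OF A] by blast
  define ns where "ns = map fst (filter (\<lambda>na. snd na = 0) n_as)"
  have "char_matrix A 0 = A"
    using A by (auto simp: char_matrix_def)
  then have dims: "dim_gen_eigenspace A 0 1 = kernel_dim A"
    "dim_gen_eigenspace A 0 2 = kernel_dim (A * A)"
    using A by (simp_all add: dim_gen_eigenspace_def numeral_2_eq_2)
  moreover have "kernel_dim (A * A) = kernel_dim A"
    using A by (simp add: kernel_dim_def ker)
  ultimately have "(\<Sum>n\<leftarrow>ns. min 1 n) = kernel_dim A" "(\<Sum>n\<leftarrow>ns. min 2 n) = kernel_dim A"
    using dim_gen_eigenspace[OF jnf] by (simp_all add: ns_def case_prod_beta')
  then show ?thesis
    using sum_list_min_1_eq_min_2[of ns] jordan_nf_order[OF jnf, of 0]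
    by (simp add: ns_def)
qed

text \<open>\<open>M\<close> is Hermitian: if \<open>M * M\<close> kills \<open>v\<close> and
  \<open>w\<close> is the image of \<open>v\<close> under \<open>M\<close>, then the squared norm of
  \<open>w\<close> equals the product of \<open>v\<close> with the conjugate of the image of
  \<open>w\<close>, which is 0.\<close>

lemma mat_kernel_square_real_symmetric:
  fixes A :: "real mat"
  assumes A: "A \<in> carrier_mat n n" and sym: "transpose_mat A = A"
  defines "M \<equiv> map_mat complex_of_real A"
  shows "mat_kernel (M * M) = mat_kernel M"
proof
  have M: "M \<in> carrier_mat n n"
    using A by (simp add: M_def)
  show "mat_kernel M \<subseteq> mat_kernel (M * M)"
    by (rule mat_kernel_mult_subset[OF M M])
  show "mat_kernel (M * M) \<subseteq> mat_kernel M"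
  proof
    fix v assume "v \<in> mat_kernel (M * M)"
    then have v: "v \<in> carrier_vec n" and "(M * M) *\<^sub>v v = 0\<^sub>v n"
      using mat_kernelD[of "M * M" n n v] M by auto
    then have MMv: "M *\<^sub>v (M *\<^sub>v v) = 0\<^sub>v n"
      using assoc_mult_mat_vec[OF M M v] by simp
    define w where "w = M *\<^sub>v v"
    have w: "w \<in> carrier_vec n"
      using M v by (simp add: w_def)
    have tr: "transpose_mat M = M"
      using sym by (simp add: M_def map_mat_transpose)
    \<comment> \<open>Conjugation commutes with \<open>M\<close> because its entries are real;
      together with \<open>tr\<close> this moves \<open>M\<close> across the Hermitian
      product.\<close>
    have conj: "conjugate (M *\<^sub>v x) = M *\<^sub>v conjugate x" if "x \<in> carrier_vec n" for x
      using that A by (intro eq_vecI) (auto simp: M_def scalar_prod_def sum_conjugate conjugate_complex_def)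
    have "w \<bullet> conjugate w = (transpose_mat M *\<^sub>v v) \<bullet> conjugate w"
      by (simp add: w_def tr)
    also have "\<dots> = v \<bullet> (M *\<^sub>v conjugate w)"
      using transpose_vec_mult_scalar[OF M _ v, of "conjugate w"] w by simp
    also have "\<dots> = v \<bullet> conjugate (M *\<^sub>v w)"
      using conj[OF w] by simp
    also have "\<dots> = 0"
      using MMv v by (simp add: w_def)
    finally have "w = 0\<^sub>v n"
      using conjugate_square_eq_0_vec[OF w] by simp
    then show "v \<in> mat_kernel M"
      using mat_kernelI[OF M v] by (simp add: w_def)
  qed
qed

text \<open>Embedding the reals into the complex numbers keeps the characteristic polynomial and the
  order of its root 0. The kernel dimension stays on the complex side, since it is only ever
  compared with another such dimension.\<close>

lemma order_char_poly_real_symmetric: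
  fixes A :: "real mat"
  assumes A: "A \<in> carrier_mat n n" and sym: "transpose_mat A = A"
  shows "Polynomial.order 0 (char_poly A) = kernel_dim (map_mat complex_of_real A)"
proof -
  interpret of_real_poly: map_poly_inj_idom_divide_hom complex_of_real ..
  have "Polynomial.order 0 (char_poly A) = Polynomial.order (complex_of_real 0) (map_poly complex_of_real (char_poly A))"
    by (rule of_real_poly.order_hom[symmetric])
  also have "\<dots> = Polynomial.order 0 (char_poly (map_mat complex_of_real A))"
    by (simp add: of_real_hom.char_poly_hom[OF A])
  also have "\<dots> = kernel_dim (map_mat complex_of_real A)"
    using order_char_poly_eq_kernel_dim mat_kernel_square_real_symmetric[OF A sym] A by simp
  finally show ?thesis .
qed

section \<open>Kernel dimension of a Schur complement\<close>

text \<open>Block elimination with \<open>K\<close> as the inverse of \<open>H\<close>: the matrix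
  factors as lower unitriangular times block diagonal times upper unitriangular. The outer factors
  are invertible, and in the middle one \<open>H\<close> contributes nothing to the kernel.\<close>

lemma kernel_dim_schur_complement:
  fixes H :: "'a :: field mat"
  assumes H: "H \<in> carrier_mat n n" and K: "K \<in> carrier_mat n n"
    and HK: "H * K = 1\<^sub>m n" and KH: "K * H = 1\<^sub>m n"
    and C: "C \<in> carrier_mat n m" and E: "E \<in> carrier_mat m n" and D: "D \<in> carrier_mat m m"
  shows "kernel_dim (four_block_mat H C E D) = kernel_dim (D - E * K * C)"
proof -
  let ?M = "four_block_mat H C E D"
  define S where "S = D - E * K * C"
  let ?L = "\<lambda>X. four_block_mat (1\<^sub>m n) (0\<^sub>m n m) X (1\<^sub>m m)"
  let ?U = "\<lambda>X. four_block_mat (1\<^sub>m n) X (0\<^sub>m m n) (1\<^sub>m m)"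
  have EK: "E * K \<in> carrier_mat m n" and KC: "K * C \<in> carrier_mat n m"
    and EKC: "E * K * C \<in> carrier_mat m m" and S: "S \<in> carrier_mat m m"
    using C D E K by (auto simp: S_def)
  have M: "?M \<in> carrier_mat (n + m) (n + m)"
    using H D by simp
  \<comment> \<open>Unitriangular block matrices multiply by adding their corner blocks, so negating
    the corner gives the inverse. \<open>UU\<close> is the upper triangular counterpart.\<close>
  have LL: "?L X * ?L Y = ?L (X + Y)" if "X \<in> carrier_mat m n" "Y \<in> carrier_mat m n" for X Y :: "'a mat"
    using that by (subst mult_four_block_mat[of _ n n _ m _ m _ _ n _ m]) auto
  have UU: "?U X * ?U Y = ?U (Y + X)" if "X \<in> carrier_mat n m" "Y \<in> carrier_mat n m" for X Y :: "'a mat"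
    using that by (subst mult_four_block_mat[of _ n n _ m _ m _ _ n _ m]) auto
  have L: "?L X \<in> carrier_mat (n + m) (n + m)" for X :: "'a mat"
    by simp
  have U: "?U X \<in> carrier_mat (n + m) (n + m)" for X :: "'a mat"
    by simp
  let ?B = "four_block_mat H (0\<^sub>m n m) (0\<^sub>m m n) S"
  have B: "?B \<in> carrier_mat (n + m) (n + m)"
    using H S by simp
  have "E * K * H = E"
    using E K H KH by (simp add: assoc_mult_mat[OF E K H])
  moreover have "H * (K * C) = C"
    using C K H HK assoc_mult_mat[OF H K C] by simp
  moreover have "E * K * C + S = D"
  proof -
    have "X + (D - X) = D" if "X \<in> carrier_mat m m" for X
      using that D by (intro eq_matI) auto
    then show ?thesis
      using EKC by (simp add: S_def)
  qed
  ultimately have "?M = ?L (E * K) * four_block_mat H C (0\<^sub>m m n) S"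
    using H C E D EK EKC S mult_four_block_mat[of "1\<^sub>m n" n n "0\<^sub>m n m" m "E * K" m "1\<^sub>m m" H n C m "0\<^sub>m m n" S]
    by simp
  moreover have "?B * ?U (K * C) = four_block_mat H C (0\<^sub>m m n) S"
    using H C KC S left_mult_zero_mat[OF KC, of m] \<open>H * (K * C) = C\<close>
      mult_four_block_mat[of H n n "0\<^sub>m n m" m "0\<^sub>m m n" m S "1\<^sub>m n" n "K * C" m "0\<^sub>m m n" "1\<^sub>m m"]
    by simp
  ultimately have fact: "?M = ?L (E * K) * (?B * ?U (K * C))"
    by simp
  have "kernel_dim ?M = kernel.dim (n + m) (?L (E * K) * (?B * ?U (K * C)))"
    using M H D fact by (simp add: kernel_dim_def)
  also have "\<dots> = kernel.dim (n + m) (?B * ?U (K * C))"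
  proof -
    have "?L (- (E * K)) * ?L (E * K) = 1\<^sub>m (n + m)"
      using LL[of "- (E * K)" "E * K"] EK uminus_l_inv_mat[OF EK] by simp
    then show ?thesis
      using mat_kernel_mult_eq[OF mult_carrier_mat[OF B U] L L] by simp
  qed
  \<comment> \<open>The left factor left the kernel itself unchanged; the right factor moves the
    kernel and preserves only its dimension.\<close>
  also have "\<dots> = kernel.dim (n + m) ?B"
  proof -
    have "?U (K * C) * ?U (- (K * C)) = 1\<^sub>m (n + m)"
      using UU[of "K * C" "- (K * C)"] KC uminus_l_inv_mat[OF KC] by simp
    then show ?thesis
      by (rule mat_kernel_dim_mult_eq_right[OF B U U])
  qed
  also have "\<dots> = kernel.dim n H + kernel.dim m S"
    by (rule kernel_four_block_0_mat[OF refl H S])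
  \<comment> \<open>Left multiplication by the invertible \<open>K\<close> keeps the kernel of
    \<open>H\<close> and turns \<open>H\<close> into the identity.\<close>
  also have "kernel.dim n H = 0"
    using kernel_one_mat(1)[of n, where 'a = 'a] mat_kernel_mult_eq[OF H K H HK]
    by (simp add: KH)
  finally show ?thesis
    using C S by (simp add: kernel_dim_def S_def)
qed

text \<open>Symmetry of both matrices turns the two orders into complex kernel dimensions, and the
  complex embedding commutes with forming the Schur complement.\<close>

lemma order_char_poly_schur_complement:
  fixes H :: "real mat"
  assumes H: "H \<in> carrier_mat n n" and K: "K \<in> carrier_mat n n"
    and HK: "H * K = 1\<^sub>m n" and KH: "K * H = 1\<^sub>m n"
    and C: "C \<in> carrier_mat n m" and E: "E \<in> carrier_mat m n" and D: "D \<in> carrier_mat m m"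
    and symM: "transpose_mat (four_block_mat H C E D) = four_block_mat H C E D"
    and symS: "transpose_mat (D - E * K * C) = D - E * K * C"
  shows "Polynomial.order 0 (char_poly (four_block_mat H C E D)) =
    Polynomial.order 0 (char_poly (D - E * K * C))"
proof -
  let ?h = "map_mat complex_of_real"
  have M: "four_block_mat H C E D \<in> carrier_mat (n + m) (n + m)"
    using H D by simp
  have S: "D - E * K * C \<in> carrier_mat m m"
    using C D E K by auto
  have inv: "?h H * ?h K = 1\<^sub>m n" "?h K * ?h H = 1\<^sub>m n"
    by (metis H K HK KH of_real_hom.mat_hom_mult of_real_hom.mat_hom_one)+
  have "?h (D - E * K * C) = ?h D - ?h (E * K * C)"
    using C D E K by (intro eq_matI) auto
  moreover have "?h (E * K * C) = ?h E * ?h K * ?h C"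
    by (simp add: of_real_hom.mat_hom_mult[OF mult_carrier_mat[OF E K] C]
        of_real_hom.mat_hom_mult[OF E K])
  moreover have "kernel_dim (four_block_mat (?h H) (?h C) (?h E) (?h D)) =
      kernel_dim (?h D - ?h E * ?h K * ?h C)"
    by (rule kernel_dim_schur_complement[OF _ _ inv]) (use K H C E D in simp_all)
  ultimately have "kernel_dim (?h (four_block_mat H C E D)) = kernel_dim (?h (D - E * K * C))"
    by (simp only: map_four_block_mat[OF H C E D])
  then show ?thesis
    using order_char_poly_real_symmetric[OF M symM] order_char_poly_real_symmetric[OF S symS]
    by simp
qed

section \<open>Adjacency entries under contraction\<close>

text \<open>Indexing by vertices instead of list positions lets the effect of the contraction be
  computed without an enumeration.\<close>

definition adj_entry :: "'a sgraph \<Rightarrow> 'a \<Rightarrow> 'a \<Rightarrow> real" where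
  "adj_entry \<Gamma> x y = (if {x, y} \<in> edges \<Gamma> then of_int (esign \<Gamma> {x, y}) else 0)"

definition adj_block :: "'a sgraph \<Rightarrow> 'a list \<Rightarrow> 'a list \<Rightarrow> real mat" where
  "adj_block \<Gamma> xs ys = mat (length xs) (length ys) (\<lambda>(i, j). adj_entry \<Gamma> (xs ! i) (ys ! j))"

lemma adj_block_carrier [simp]: "adj_block \<Gamma> xs ys \<in> carrier_mat (length xs) (length ys)"
  by (simp add: adj_block_def)

lemma adj_entry_commute: "adj_entry \<Gamma> x y = adj_entry \<Gamma> y x"
  by (simp add: adj_entry_def insert_commute)

lemma adj_entry_self:
  assumes "signed_graph \<Gamma>"
  shows "adj_entry \<Gamma> x x = 0"
proof -
  have "{x} \<notin> edges \<Gamma>"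
    using assms by (fastforce simp: signed_graph_def)
  then show ?thesis
    by (simp add: adj_entry_def)
qed

lemma edge_verts:
  assumes "signed_graph \<Gamma>" "{x, y} \<in> edges \<Gamma>"
  shows "x \<in> verts \<Gamma>" "y \<in> verts \<Gamma>"
proof -
  obtain a b where "{x, y} = {a, b}" "a \<in> verts \<Gamma>" "b \<in> verts \<Gamma>"
    using assms unfolding signed_graph_def by blast
  then show "x \<in> verts \<Gamma>" "y \<in> verts \<Gamma>"
    by (auto simp: doubleton_eq_iff)
qed

lemma adj_entry_nbrs:
  assumes "w \<in> verts \<Gamma>" "w \<notin> nbrs \<Gamma> v"
  shows "adj_entry \<Gamma> v w = 0"
  using assms by (simp add: adj_entry_def nbrs_def)

lemma transpose_adj_matrix: "transpose_mat (adj_matrix \<Gamma> vs) = adj_matrix \<Gamma> vs"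
  by (rule eq_matI) (auto simp: adj_matrix_def insert_commute)

lemma adj_matrix_append:
  "adj_matrix \<Gamma> (xs @ ys) = four_block_mat (adj_block \<Gamma> xs xs) (adj_block \<Gamma> xs ys)
     (adj_block \<Gamma> ys xs) (adj_block \<Gamma> ys ys)"
  by (rule eq_matI) (auto simp: adj_matrix_def adj_block_def adj_entry_def nth_append)

text \<open>Both ends of the path are neighbors of \<open>v2\<close>, and its degree 2 leaves room
  for no other. Hence the row of \<open>v2\<close> vanishes outside the path.\<close>

lemma special_path_nbrs_middle:
  assumes "signed_graph \<Gamma>" "special_path \<Gamma> v1 v2 v3"
  shows "nbrs \<Gamma> v2 = {v1, v3}"
proof -
  have "finite (nbrs \<Gamma> v2)"
    using assms(1) by (simp add: signed_graph_def nbrs_def)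
  moreover have "{v1, v3} \<subseteq> nbrs \<Gamma> v2" "card (nbrs \<Gamma> v2) = card {v1, v3}"
    using assms(2) by (auto simp: special_path_def nbrs_def vdeg_def insert_commute)
  ultimately show ?thesis
    by (metis card_subset_eq)
qed

lemma adj_entry_contract_path_old:
  assumes "signed_graph \<Gamma>" "special_path \<Gamma> v1 v2 v3" "u \<notin> verts \<Gamma> - {v1, v2, v3}"
    and "x \<in> verts \<Gamma> - {v1, v2, v3}" "y \<in> verts \<Gamma> - {v1, v2, v3}"
  shows "adj_entry (contract_path \<Gamma> v1 v2 v3 u) x y = adj_entry \<Gamma> x y"
proof -
  have "u \<noteq> x" "u \<noteq> y"
    using assms(3-5) by auto
  then have "{x, y} \<in> edges (contract_path \<Gamma> v1 v2 v3 u) \<longleftrightarrow> {x, y} \<in> edges \<Gamma>"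
    using assms(4,5) by (auto simp: contract_path_def doubleton_eq_iff)
  then show ?thesis
    using esign_contract_path(3)[OF assms(1-3), of "{x, y}"] assms(4,5)
    by (auto simp: adj_entry_def)
qed

text \<open>At most one summand is nonzero, because \<open>v1\<close> and \<open>v3\<close> have no
  common neighbor besides \<open>v2\<close>. The sum is the form in which the Schur complement
  delivers this entry.\<close>

lemma adj_entry_contract_path_new:
  assumes "signed_graph \<Gamma>" "special_path \<Gamma> v1 v2 v3" "u \<notin> verts \<Gamma> - {v1, v2, v3}"
    and w: "w \<in> verts \<Gamma> - {v1, v2, v3}"
  shows "adj_entry (contract_path \<Gamma> v1 v2 v3 u) u w = adj_entry \<Gamma> v1 w + adj_entry \<Gamma> v3 w"
proof -
  let ?C = "contract_path \<Gamma> v1 v2 v3 u"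
  have "u \<noteq> w"
    using assms(3) w by auto
  have nbr: "{v, w} \<in> edges \<Gamma> \<longleftrightarrow> w \<in> nbrs \<Gamma> v" for v
    using w by (simp add: nbrs_def)
  \<comment> \<open>If \<open>u\<close> reuses the name of a deleted vertex, \<open>{u, w}\<close>
    can be an edge of \<open>\<Gamma>\<close>, but then it meets the path and does not survive as an
    old edge.\<close>
  have "{u, w} \<in> edges \<Gamma> \<Longrightarrow> {u, w} \<inter> {v1, v2, v3} \<noteq> {}"
    using assms(3) edge_verts[OF assms(1)] by blast
  then have edge: "{u, w} \<in> edges ?C \<longleftrightarrow> w \<in> nbrs \<Gamma> v1 \<or> w \<in> nbrs \<Gamma> v3"
    using w \<open>u \<noteq> w\<close> by (auto simp: contract_path_def doubleton_eq_iff)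
  have disj: "\<not> (w \<in> nbrs \<Gamma> v1 \<and> w \<in> nbrs \<Gamma> v3)"
    using assms(2) w by (auto simp: special_path_def)
  have "w \<noteq> v2"
    using w by simp
  consider "w \<in> nbrs \<Gamma> v1" | "w \<in> nbrs \<Gamma> v3" | "w \<notin> nbrs \<Gamma> v1" "w \<notin> nbrs \<Gamma> v3"
    by blast
  then show ?thesis
  proof cases
    case 1
    then show ?thesis
      using disj edge nbr esign_contract_path(1)[OF assms(1-3), of w] \<open>w \<noteq> v2\<close>
      by (simp add: adj_entry_def insert_commute)
  next
    case 2
    then show ?thesis
      using disj edge nbr esign_contract_path(2)[OF assms(1-3), of w] \<open>w \<noteq> v2\<close>
      by (simp add: adj_entry_def insert_commute)
  next
    case 3
    then show ?thesis
      using edge nbr by (simp add: adj_entry_def)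
  qed
qed

section \<open>The contracted graph as a Schur complement\<close>

theorem corollary2p8:
  fixes \<Gamma> :: "'a sgraph" and v1 v2 v3 u :: 'a
  assumes "signed_graph \<Gamma>"
    and "special_path \<Gamma> v1 v2 v3"
    and "esign \<Gamma> {v1, v2} = -1"
    and "esign \<Gamma> {v2, v3} = 1"
    and "u \<notin> verts \<Gamma> - {v1, v2, v3}"
  shows "nullity (contract_path \<Gamma> v1 v2 v3 u) = nullity \<Gamma>"
proof -
  let ?C = "contract_path \<Gamma> v1 v2 v3 u"
  let ?a = "adj_entry \<Gamma>"
  have path: "v1 \<in> verts \<Gamma>" "v2 \<in> verts \<Gamma>" "v3 \<in> verts \<Gamma>" "distinct [v1, v2, v3]"
    "{v1, v2} \<in> edges \<Gamma>" "{v2, v3} \<in> edges \<Gamma>" "{v1, v3} \<notin> edges \<Gamma>"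
    using assms(2) by (auto simp: special_path_def)
  have "finite (verts \<Gamma> - {v1, v2, v3})"
    using assms(1) by (simp add: signed_graph_def)
  from finite_distinct_list[OF this]
  obtain ws where ws: "distinct ws" "set ws = verts \<Gamma> - {v1, v2, v3}"
    by blast
  define ps where "ps = [v2, v3]"
  define xs where "xs = v1 # ws"
  define ys where "ys = u # ws"
  define H where "H = adj_block \<Gamma> ps ps"
  define B where "B = adj_block \<Gamma> ps xs"
  define E where "E = adj_block \<Gamma> xs ps"
  define D where "D = adj_block \<Gamma> xs xs"
  have "?a v2 v3 = 1" "?a v1 v2 = -1" "?a v1 v3 = 0"
    using path assms(3,4) by (simp_all add: adj_entry_def)
  then have a: "?a v2 v3 = 1" "?a v3 v2 = 1" "?a v2 v1 = -1" "?a v1 v2 = -1"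
    "?a v1 v3 = 0" "?a v3 v1 = 0"
    by (metis adj_entry_commute)+
  have a_self: "?a x x = 0" for x
    by (rule adj_entry_self[OF assms(1)])
  have a_mid: "?a v2 w = 0" "?a w v2 = 0" if "w \<in> set ws" for w
  proof -
    have "w \<in> verts \<Gamma>" "w \<notin> nbrs \<Gamma> v2"
      using that unfolding ws(2) special_path_nbrs_middle[OF assms(1,2)] by blast+
    then show "?a v2 w = 0"
      by (rule adj_entry_nbrs)
    then show "?a w v2 = 0"
      by (metis adj_entry_commute)
  qed
  have len: "length ps = 2"
    by (simp add: ps_def)
  have carr: "H \<in> carrier_mat 2 2" "B \<in> carrier_mat 2 (length xs)" "E \<in> carrier_mat (length xs) 2"
    "D \<in> carrier_mat (length xs) (length xs)"
    using adj_block_carrier[of \<Gamma> ps ps] adj_block_carrier[of \<Gamma> ps xs]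
      adj_block_carrier[of \<Gamma> xs ps] adj_block_carrier[of \<Gamma> xs xs]
    unfolding H_def B_def E_def D_def len .
  have H: "H = mat 2 2 (\<lambda>(i, j). if i = j then 0 else 1)"
    by (rule eq_matI) (auto simp: H_def adj_block_def ps_def a a_self less_2_cases_iff)
  have sum_2: "sum f {0..<2} = f 0 + f (Suc 0)" for f :: "nat \<Rightarrow> real"
    by (simp add: numeral_2_eq_2)
  \<comment> \<open>\<open>H\<close> swaps two coordinates and is therefore its own inverse, so it
    also serves as \<open>K\<close>.\<close>
  have HH: "H * H = 1\<^sub>m 2"
    by (rule eq_matI) (auto simp: H scalar_prod_def sum_2 less_2_cases_iff)
  have M: "adj_matrix \<Gamma> (ps @ xs) = four_block_mat H B E D"
    by (simp add: adj_matrix_append H_def B_def E_def D_def)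
  \<comment> \<open>The swap \<open>H\<close> pairs the \<open>v2\<close> column of \<open>E\<close>
    with the \<open>v3\<close> row of \<open>B\<close>, and vice versa.\<close>
  have S_entry: "(D - E * H * B) $$ (i, j) =
      ?a (xs ! i) (xs ! j) - (?a (xs ! i) v2 * ?a v3 (xs ! j) + ?a (xs ! i) v3 * ?a v2 (xs ! j))"
    if "i < length xs" "j < length xs" for i j
    using that
    by (simp add: H D_def E_def B_def adj_block_def ps_def scalar_prod_def sum_2)
  note C_self = adj_entry_self[OF signed_graph_contract_path[OF assms(1,2,5)]]
    and old = adj_entry_contract_path_old[OF assms(1,2,5)]
    and new = adj_entry_contract_path_new[OF assms(1,2,5)]
  have S: "D - E * H * B = adj_matrix ?C ys"
  proof (rule eq_matI)
    fix i j assume "i < dim_row (adj_matrix ?C ys)" "j < dim_col (adj_matrix ?C ys)"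
    then have ij: "i < Suc (length ws)" "j < Suc (length ws)"
      by (simp_all add: adj_matrix_def ys_def)
    have mem: "ws ! k \<in> verts \<Gamma> - {v1, v2, v3}" "ws ! k \<in> set ws" if "k < length ws" for k
      using that ws(2) nth_mem[of k ws] by auto
    have "adj_matrix ?C ys $$ (i, j) = adj_entry ?C (ys ! i) (ys ! j)"
      using ij by (simp add: adj_matrix_def adj_entry_def ys_def)
    also have "\<dots> = ?a (xs ! i) (xs ! j) -
        (?a (xs ! i) v2 * ?a v3 (xs ! j) + ?a (xs ! i) v3 * ?a v2 (xs ! j))"
    proof (cases i; cases j)
      \<comment> \<open>Here the signs enter: \<open>?a v1 v2 = -1\<close> turns the subtracted
        product into \<open>+ ?a v3 w\<close> with \<open>w = ws ! k\<close>, and the other product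
        vanishes because \<open>?a v1 v3 = 0\<close>. This is the entry given by
        \<open>new\<close>.\<close>
      fix k assume "i = 0" "j = Suc k"
      then show ?thesis
        using ij mem[of k] new by (simp add: xs_def ys_def a a_mid)
    next
      fix k assume "i = Suc k" "j = 0"
      then show ?thesis
        using ij mem[of k] new[of "ws ! k"] adj_entry_commute[of ?C u "ws ! k"]
          adj_entry_commute[of \<Gamma> v1 "ws ! k"] adj_entry_commute[of \<Gamma> v3 "ws ! k"]
        by (simp add: xs_def ys_def a a_mid)
    next
      \<comment> \<open>Each correction product contains an entry between \<open>v2\<close> and a
        vertex off the path, so it is 0.\<close>
      fix k l assume "i = Suc k" "j = Suc l"
      then show ?thesis
        using ij mem[of k] mem[of l] old by (simp add: xs_def ys_def a_mid)
    qed (simp add: xs_def ys_def a a_self C_self)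
    finally show "(D - E * H * B) $$ (i, j) = adj_matrix ?C ys $$ (i, j)"
      using S_entry ij by (simp add: xs_def)
  qed (use carr in \<open>simp_all add: adj_matrix_def xs_def ys_def\<close>)
  have "nullity \<Gamma> = Polynomial.order 0 (char_poly (adj_matrix \<Gamma> (ps @ xs)))"
    using ws path by (intro nullity_enum) (auto simp: ps_def xs_def)
  also have "\<dots> = Polynomial.order 0 (char_poly (adj_matrix ?C ys))"
    using order_char_poly_schur_complement[OF carr(1,1) HH HH carr(2-4)]
      transpose_adj_matrix[of \<Gamma> "ps @ xs"] transpose_adj_matrix[of ?C ys]
    by (simp add: M S)
  also have "\<dots> = nullity ?C"
    using ws assms(5) by (intro nullity_enum[symmetric]) (auto simp: ys_def contract_path_def)
  finally show ?thesis
    by simp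
qed

end
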